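(* Let $S$ be a semigroup which is the union of $n$ minimal left ideals. Then the clique number and the chromatic number of the intersection ideal graph $\Gamma(S)$ satisfy $\omega(\Gamma(S))=\chi(\Gamma(S))=2^{n-1}-1$.
   Context: A left ideal of a semigroup $S$ is a non-empty subset $I\subseteq S$ with $SI\subseteq I$; it is nontrivial if $I\neq S$. The intersection of two left ideals is nontrivial if it is non-empty. Minimal left ideals are understood to be nontrivial: a nontrivial left ideal is minimal if it does not properly contain any left ideal of $S$. The intersection ideal graph $\Gamma(S)$ is the simple undirected graph whose vertices are the nontrivial left ideals of $S$, with two distinct vertices $I,J$ adjacent if and only if $I\cap J$ is nontrivial. "Union of $n$ minimal left ideals" means the union of $n$ pairwise distinct minimal left ideals. *)

theory Defs
  imports "HOL-Library.Ramsey" "HOL-Library.Extended_Nat"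
begin

text \<open>The semigroup is the whole carrier type \<open>'a::semigroup_mult\<close>.\<close>

definition left_ideal :: "'a::semigroup_mult set \<Rightarrow> bool" where
  "left_ideal I \<longleftrightarrow> I \<noteq> {} \<and> (\<forall>s. \<forall>x\<in>I. s * x \<in> I)"

definition nontrivial_left_ideal :: "'a::semigroup_mult set \<Rightarrow> bool" where
  "nontrivial_left_ideal I \<longleftrightarrow> left_ideal I \<and> I \<noteq> UNIV"

definition minimal_left_ideal :: "'a::semigroup_mult set \<Rightarrow> bool" where
  "minimal_left_ideal I \<longleftrightarrow> nontrivial_left_ideal I \<and> \<not> (\<exists>J. left_ideal J \<and> J \<subset> I)"

text \<open>A simple undirected graph is a pair of a vertex set and a set of two-element edges.\<close>

type_synonym 'v ugraph = "'v set \<times> 'v set set"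

definition intersection_ideal_graph :: "'a::semigroup_mult set ugraph" where
  "intersection_ideal_graph =
     ({I. nontrivial_left_ideal I},
      {{I, J} | I J. nontrivial_left_ideal I \<and> nontrivial_left_ideal J \<and> I \<noteq> J \<and> I \<inter> J \<noteq> {}})"

text \<open>Both invariants are extended naturals, so that they are meaningful for infinite graphs as
  well: the clique number is \<open>\<infinity>\<close> if finite cliques are unboundedly large, and the chromatic
  number is \<open>\<infinity>\<close>, the infimum of the empty set, if no finite number of colours suffices.\<close>

definition clique_number :: "'v ugraph \<Rightarrow> enat" where
  "clique_number G = (SUP C\<in>{C. C \<subseteq> fst G \<and> finite C \<and> clique C (snd G)}. enat (card C))"

definition proper_colouring :: "'v ugraph \<Rightarrow> nat \<Rightarrow> ('v \<Rightarrow> nat) \<Rightarrow> bool" where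
  "proper_colouring G k c \<longleftrightarrow>
     (\<forall>v\<in>fst G. c v < k) \<and> (\<forall>v\<in>fst G. \<forall>w\<in>fst G. {v, w} \<in> snd G \<longrightarrow> c v \<noteq> c w)"

definition chromatic_number :: "'v ugraph \<Rightarrow> enat" where
  "chromatic_number G = (INF k\<in>{k. \<exists>c. proper_colouring G k c}. enat k)"

end

theory Submission
  imports Defs
begin

text \<open>Distinct minimal left ideals are disjoint, and a left ideal contains every minimal left ideal
  that it meets. Hence the left ideals of \<open>S\<close> are exactly the unions of non-empty families of the
  \<open>n\<close> given ones, and the complement of a nontrivial left ideal is again one. The nontrivial left
  ideals containing a fixed minimal one form a clique of size \<open>2 ^ (n - 1) - 1\<close>. As many colours
  suffice, because each nontrivial left ideal can share its colour with its complement, to which it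
  is not adjacent, and exactly one ideal of each such pair lies in the clique.\<close>

text \<open>The vertices of a clique receive pairwise distinct colours.\<close>

lemma card_clique_le_colours:
  assumes "C \<subseteq> fst G" and "clique C (snd G)" and "proper_colouring G k c"
  shows "card C \<le> k"
proof -
  have "inj_on c C"
    using assms unfolding inj_on_def clique_def proper_colouring_def by blast
  moreover have "c ` C \<subseteq> {..<k}"
    using assms unfolding proper_colouring_def by auto
  ultimately show ?thesis
    using card_inj_on_le[of c C "{..<k}"] by simp
qed

text \<open>Weak duality: no clique is larger than any number of sufficient colours, so a clique and
  a colouring of the same size certify both the supremum and the infimum.\<close>

lemma clique_number_eq_chromatic_number:
  assumes C: "C \<subseteq> fst G" "finite C" "clique C (snd G)" and c: "proper_colouring G (card C) c"
  shows "clique_number G = enat (card C)" and "chromatic_number G = enat (card C)"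
proof -
  show "clique_number G = enat (card C)"
    unfolding clique_number_def
  proof (rule antisym)
    show "(SUP D\<in>{D. D \<subseteq> fst G \<and> finite D \<and> clique D (snd G)}. enat (card D)) \<le> enat (card C)"
      using card_clique_le_colours[OF _ _ c] by (intro SUP_least) auto
    show "enat (card C) \<le> (SUP D\<in>{D. D \<subseteq> fst G \<and> finite D \<and> clique D (snd G)}. enat (card D))"
      using C by (intro SUP_upper) auto
  qed
  show "chromatic_number G = enat (card C)"
    unfolding chromatic_number_def
  proof (rule antisym)
    show "(INF k\<in>{k. \<exists>c. proper_colouring G k c}. enat k) \<le> enat (card C)"
      using c by (intro INF_lower) auto
    show "enat (card C) \<le> (INF k\<in>{k. \<exists>c. proper_colouring G k c}. enat k)"
      using card_clique_le_colours[OF C(1,3)] by (intro INF_greatest) auto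
  qed
qed

lemma left_ideal_Union:
  assumes "A \<noteq> {}" and "\<And>I. I \<in> A \<Longrightarrow> left_ideal I"
  shows "left_ideal (\<Union>A)"
  using assms unfolding left_ideal_def by blast

text \<open>The intersection is a left ideal inside \<open>I\<close>, and minimality forbids it to
  be a proper subset.\<close>

lemma minimal_left_ideal_subset:
  assumes "minimal_left_ideal I" and "left_ideal L" and "I \<inter> L \<noteq> {}"
  shows "I \<subseteq> L"
proof -
  have "left_ideal (I \<inter> L)"
    using assms unfolding minimal_left_ideal_def nontrivial_left_ideal_def left_ideal_def by auto
  then have "\<not> I \<inter> L \<subset> I"
    using assms(1) unfolding minimal_left_ideal_def by blast
  then show ?thesis
    by blast
qed

text \<open>Being non-empty, \<open>I\<close> meets some member of \<open>A\<close>; two minimal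
  left ideals that meet contain each other. This makes a family of minimal left ideals recoverable
  from its union.\<close>

lemma minimal_left_ideal_mem:
  assumes I: "minimal_left_ideal I" and A: "\<And>J. J \<in> A \<Longrightarrow> minimal_left_ideal J" and sub: "I \<subseteq> \<Union>A"
  shows "I \<in> A"
proof -
  have li: "left_ideal J" if "minimal_left_ideal J" for J :: "'a set"
    using that unfolding minimal_left_ideal_def nontrivial_left_ideal_def by blast
  then have "I \<noteq> {}"
    using I unfolding left_ideal_def by blast
  then obtain J where J: "J \<in> A" "I \<inter> J \<noteq> {}"
    using sub by blast
  then have "I \<subseteq> J" "J \<subseteq> I"
    using minimal_left_ideal_subset li I A by (metis inf_commute)+
  then show ?thesis
    using J by auto
qed

lemma left_ideal_compl:
  fixes M :: "'a::semigroup_mult set set" and L :: "'a set"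
  assumes M: "\<And>I. I \<in> M \<Longrightarrow> minimal_left_ideal I" "\<Union>M = UNIV" and L: "nontrivial_left_ideal L"
  shows "nontrivial_left_ideal (- L)"
proof -
  have li: "left_ideal L" and ne: "L \<noteq> UNIV" "L \<noteq> {}"
    using L unfolding nontrivial_left_ideal_def left_ideal_def by auto
  have "s * x \<in> - L" if "x \<in> - L" for s x
  proof -
    obtain I where I: "I \<in> M" "x \<in> I"
      using M(2) by blast
    then have "s * x \<in> I"
      using M(1) unfolding minimal_left_ideal_def nontrivial_left_ideal_def left_ideal_def by blast
    \<comment> \<open>Since \<open>I\<close> is not inside \<open>L\<close>, it misses
      \<open>L\<close> entirely, and so \<open>s * x\<close> stays outside \<open>L\<close>.\<close>
    moreover have "\<not> I \<subseteq> L"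
      using I that by blast
    ultimately show ?thesis
      using minimal_left_ideal_subset[OF M(1)[OF I(1)] li] by blast
  qed
  then show ?thesis
    using ne unfolding nontrivial_left_ideal_def left_ideal_def by blast
qed

lemma bij_betw_left_ideals:
  fixes M :: "'a::semigroup_mult set set"
  assumes M: "\<And>I. I \<in> M \<Longrightarrow> minimal_left_ideal I" "\<Union>M = UNIV"
  shows "bij_betw Union (Pow M - {{}, M}) {L. nontrivial_left_ideal L}"
proof -
  have li: "left_ideal I" if "I \<in> M" for I
    using M(1)[OF that] unfolding minimal_left_ideal_def nontrivial_left_ideal_def by blast
  have mem: "I \<in> A" if "A \<subseteq> M" "I \<in> M" "I \<subseteq> \<Union>A" for A I
    using minimal_left_ideal_mem[of I A] M(1) that by blast
  then have inj: "inj_on Union (Pow M)"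
    by (intro inj_onI) (blast intro: Union_upper)
  have "Union ` (Pow M - {{}, M}) = {L. nontrivial_left_ideal L}"
  proof (intro equalityI subsetI)
    fix L assume "L \<in> Union ` (Pow M - {{}, M})"
    then obtain A where A: "A \<subseteq> M" "A \<noteq> {}" "A \<noteq> M" "L = \<Union>A"
      by auto
    \<comment> \<open>\<open>M\<close> itself has union \<open>UNIV\<close>, so injectivity keeps
      every other family from covering \<open>UNIV\<close>.\<close>
    then have "L \<noteq> UNIV"
      using inj_onD[OF inj, of A M] M(2) by auto
    then show "L \<in> {L. nontrivial_left_ideal L}"
      using left_ideal_Union[of A] li A unfolding nontrivial_left_ideal_def by auto
  next
    fix L :: "'a set" assume "L \<in> {L. nontrivial_left_ideal L}"
    then have L: "left_ideal L" "L \<noteq> UNIV" "L \<noteq> {}"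
      unfolding nontrivial_left_ideal_def left_ideal_def by auto
    \<comment> \<open>Each point of \<open>L\<close> lies in some member of \<open>M\<close>, which
      then meets \<open>L\<close> and is contained in it.\<close>
    have "L = \<Union>{I \<in> M. I \<subseteq> L}"
    proof (intro equalityI subsetI)
      fix x assume "x \<in> L"
      moreover obtain I where "I \<in> M" "x \<in> I"
        using M(2) by blast
      ultimately show "x \<in> \<Union>{I \<in> M. I \<subseteq> L}"
        using minimal_left_ideal_subset[OF M(1) L(1)] by blast
    qed blast
    moreover from this have "{I \<in> M. I \<subseteq> L} \<in> Pow M - {{}, M}"
      using L(2,3) M(2) by auto
    ultimately show "L \<in> Union ` (Pow M - {{}, M})"
      by blast
  qed
  moreover have "inj_on Union (Pow M - {{}, M})"
    using inj by (rule inj_on_subset) blast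
  ultimately show ?thesis
    unfolding bij_betw_def by blast
qed

text \<open>Such ideals correspond to families \<open>A\<close> with \<open>m \<in> A\<close> and
  \<open>A \<noteq> M\<close>, that is, to subsets of \<open>M - {m}\<close> other than
  \<open>M - {m}\<close> itself. This exclusion is the final \<open>- 1\<close>; the empty subset is
  kept, as it yields the family \<open>{m}\<close>.\<close>

lemma card_left_ideals_containing:
  fixes M :: "'a::semigroup_mult set set"
  assumes M: "\<And>I. I \<in> M \<Longrightarrow> minimal_left_ideal I" "\<Union>M = UNIV"
    and fin: "finite M" and m: "m \<in> M"
  shows "card {L. nontrivial_left_ideal L \<and> m \<subseteq> L} = 2 ^ (card M - 1) - 1"
    and "finite {L. nontrivial_left_ideal L \<and> m \<subseteq> L}"
proof -
  let ?C = "{L. nontrivial_left_ideal L \<and> m \<subseteq> L}"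
  let ?P = "Pow (M - {m}) - {M - {m}}"
  note bij = bij_betw_left_ideals[OF M]
  have ins: "insert m ` ?P = {A \<in> Pow M - {{}, M}. m \<in> A}"
  proof (intro equalityI subsetI)
    fix A assume "A \<in> {A \<in> Pow M - {{}, M}. m \<in> A}"
    then have "A = insert m (A - {m})" "A - {m} \<in> ?P"
      using m by auto
    then show "A \<in> insert m ` ?P"
      by blast
  qed (use m in auto)
  have mem: "m \<in> A" if "A \<subseteq> M" "m \<subseteq> \<Union>A" for A
    using minimal_left_ideal_mem[of m A] M(1) m that by blast
  have "Union ` {A \<in> Pow M - {{}, M}. m \<in> A} = ?C"
  proof (intro equalityI subsetI)
    fix L assume "L \<in> Union ` {A \<in> Pow M - {{}, M}. m \<in> A}"
    then show "L \<in> ?C"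
      using bij_betw_imp_surj_on[OF bij] by blast
  next
    fix L assume L: "L \<in> ?C"
    then obtain A where "A \<in> Pow M - {{}, M}" "L = \<Union>A"
      using bij_betw_imp_surj_on[OF bij] by blast
    then show "L \<in> Union ` {A \<in> Pow M - {{}, M}. m \<in> A}"
      using L mem by auto
  qed
  then have C: "?C = Union ` insert m ` ?P"
    using ins by simp
  then show "finite ?C"
    using fin by simp
  have "card ?C = card (insert m ` ?P)"
    unfolding C using bij_betw_imp_inj_on[OF bij] ins by (intro card_image) (auto intro: inj_on_subset)
  also have "\<dots> = card ?P"
    \<comment> \<open>Inserting \<open>m\<close> is injective here because no member of
      \<open>?P\<close> contains \<open>m\<close>.\<close>
    by (intro card_image inj_onI) (auto dest: insert_ident[THEN iffD1, rotated 2])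
  also have "\<dots> = 2 ^ (card M - 1) - 1"
    using fin m by (simp add: card_Pow)
  finally show "card ?C = 2 ^ (card M - 1) - 1" .
qed

theorem lemma4p11:
  fixes M :: "'a::semigroup_mult set set" and n :: nat
  assumes "finite M" and "card M = n"
    and "\<And>I. I \<in> M \<Longrightarrow> minimal_left_ideal I"
    and "\<Union>M = UNIV"
  shows "clique_number (intersection_ideal_graph :: 'a set ugraph) = enat (2 ^ (n - 1) - 1) \<and>
         chromatic_number (intersection_ideal_graph :: 'a set ugraph) = enat (2 ^ (n - 1) - 1)"
proof -
  let ?G = "intersection_ideal_graph :: 'a set ugraph"
  obtain m where m: "m \<in> M"
    using assms(4) by (metis Union_empty UNIV_not_empty ex_in_conv)
  define C where "C = {L. nontrivial_left_ideal L \<and> m \<subseteq> L}"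
  have card_C: "card C = 2 ^ (n - 1) - 1" and fin: "finite C"
    using card_left_ideals_containing[OF assms(3,4,1) m] assms(2) unfolding C_def by auto
  have min: "minimal_left_ideal m" and ne: "m \<noteq> {}"
    using assms(3)[OF m]
    unfolding minimal_left_ideal_def nontrivial_left_ideal_def left_ideal_def by auto
  have V: "C \<subseteq> fst ?G"
    unfolding C_def intersection_ideal_graph_def by auto
  have cl: "clique C (snd ?G)"
    using ne unfolding clique_def C_def intersection_ideal_graph_def by fastforce
  \<comment> \<open>The clique members themselves serve as colours, numbered by
    \<open>f\<close>.\<close>
  obtain f where f: "bij_betw f C {0..<card C}"
    using ex_bij_betw_finite_nat[OF fin] by blast
  \<comment> \<open>\<open>r\<close> picks from the pair \<open>L\<close>, \<open>- L\<close> the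
    member lying in the clique.\<close>
  define r where "r L = (if m \<subseteq> L then L else - L)" for L
  have r: "r L \<in> C" if L: "nontrivial_left_ideal L" for L
  proof (cases "m \<subseteq> L")
    case False
    have "m \<inter> L = {}"
      using minimal_left_ideal_subset[OF min] L False unfolding nontrivial_left_ideal_def by blast
    then show ?thesis
      using False left_ideal_compl[OF assms(3,4) L] unfolding r_def C_def by auto
  qed (use L in \<open>auto simp: r_def C_def\<close>)
  have "proper_colouring ?G (card C) (f \<circ> r)"
    unfolding proper_colouring_def
  proof (intro conjI ballI impI notI)
    fix L assume "L \<in> fst ?G"
    then show "(f \<circ> r) L < card C"
      using r bij_betwE[OF f] unfolding intersection_ideal_graph_def by auto
  next
    fix L K assume LK: "L \<in> fst ?G" "K \<in> fst ?G" and e: "{L, K} \<in> snd ?G"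
      and eq: "(f \<circ> r) L = (f \<circ> r) K"
    have "r L \<in> C" "r K \<in> C"
      using LK r unfolding intersection_ideal_graph_def by auto
    then have "r L = r K"
      using eq bij_betw_imp_inj_on[OF f] unfolding inj_on_def by auto
    \<comment> \<open>Equal representatives leave only \<open>L = K\<close> or
      \<open>L = - K\<close>.\<close>
    then have "L = K \<or> L \<inter> K = {}"
      unfolding r_def by (auto split: if_splits)
    moreover have "L \<noteq> K \<and> L \<inter> K \<noteq> {}"
      using e unfolding intersection_ideal_graph_def by (auto simp: doubleton_eq_iff)
    ultimately show False
      by blast
  qed
  from clique_number_eq_chromatic_number[OF V fin cl this] show ?thesis
    unfolding card_C by simp
qed

end
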